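(* There exist an absolute constant $C>0$ and a function $\delta:\mathbb{N}\to[0,\infty)$ with $\delta(n)\to0$ as $n\to\infty$ such that the following holds. Let $n\ge4$ be even, let $k,M$ be positive integers, let $\gamma>0$, let $v_0\in V(C_{n,k})$, and let $f$ be chosen uniformly at random from $\mathrm{Lip}_{v_0}(C_{n,k};M)$. If $k\le \frac{\log n}{\gamma}$, then $$\mathbb{P}\left[R(f)<C\gamma M\right]\le\delta(n).$$
   Context: $\log$ denotes $\log_2$. For $n,k\in\mathbb{N}$ with $n$ even, $C_{n,k}$ is the graph with vertex set $[n]\times[k]$ in which $(u,u')$ and $(w,w')$ are adjacent iff $u-w\equiv\pm1\pmod n$ (a cycle of $n$ layers of $k$ vertices each, with complete bipartite graphs between cyclically consecutive layers and no edges inside layers). For a connected finite graph $G$, $v_0\in V(G)$ and a positive integer $M$, $\mathrm{Lip}_{v_0}(G;M)$ is the (finite) set of functions $f:V(G)\to\mathbb{Z}$ with $f(v_0)=0$ and $|f(u)-f(v)|\le M$ for all $\{u,v\}\in E(G)$. The range of $f$ is $R(f):=\max_{v\in V(G)}f(v)-\min_{v\in V(G)}f(v)+1$. *)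

theory Defs
  imports "HOL-Probability.Probability" "HOL-Number_Theory.Cong"
begin

text \<open>
  A finite simple graph is given by its vertex set and its set of edges, an edge being
  the two-element set of its endpoints.
\<close>

definition cyc_verts :: "nat \<Rightarrow> nat \<Rightarrow> (nat \<times> nat) set" where
  "cyc_verts n k = {1..n} \<times> {1..k}"

text \<open>The difference of layer indices is taken in the integers, not truncated in the naturals.\<close>

definition cyc_edges :: "nat \<Rightarrow> nat \<Rightarrow> (nat \<times> nat) set set" where
  "cyc_edges n k = {{(u, u'), (w, w')} | u u' w w'.
     (u, u') \<in> cyc_verts n k \<and> (w, w') \<in> cyc_verts n k \<and>
     ([int u - int w = 1] (mod int n) \<or> [int u - int w = - 1] (mod int n))}"

text \<open>
  Functions on \<open>V\<close> are represented as extensional functions (equal to \<open>undefined\<close> off \<open>V\<close>),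
  so that each function on \<open>V\<close> is counted exactly once.
\<close>

definition Lip :: "'a set \<Rightarrow> 'a set set \<Rightarrow> 'a \<Rightarrow> nat \<Rightarrow> ('a \<Rightarrow> int) set" where
  "Lip V E v0 M = {f \<in> V \<rightarrow>\<^sub>E UNIV. f v0 = 0 \<and>
     (\<forall>u v. {u, v} \<in> E \<longrightarrow> \<bar>f u - f v\<bar> \<le> int M)}"

definition lip_range :: "'a set \<Rightarrow> ('a \<Rightarrow> int) \<Rightarrow> int" where
  "lip_range V f = Max (f ` V) - Min (f ` V) + 1"

text \<open>
  The set of Lipschitz functions on the blown-up cycle is finite and nonempty, so
  \<open>pmf_of_set\<close> of it really is the uniform distribution.
\<close>

lemma zero_in_Lip:
  assumes "v0 \<in> cyc_verts n k"
  shows "(\<lambda>v\<in>cyc_verts n k. 0) \<in> Lip (cyc_verts n k) (cyc_edges n k) v0 M"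
  using assms by (auto simp: Lip_def restrict_def cyc_edges_def doubleton_eq_iff)

lemma finite_Lip_cyc:
  assumes n: "n \<ge> 2" and k: "k > 0" and v0: "v0 \<in> cyc_verts n k"
  shows "finite (Lip (cyc_verts n k) (cyc_edges n k) v0 M)"
proof -
  let ?V = "cyc_verts n k"
  define B where "B = 2 * (int n + 1) * int M"
  have bound: "\<bar>f v\<bar> \<le> B"
    if f: "f \<in> Lip ?V (cyc_edges n k) v0 M" and v: "v \<in> ?V" for f v
  proof -
    have edge_step: "\<bar>f (Suc u, j) - f (u, i)\<bar> \<le> int M"
      if "1 \<le> u" "Suc u \<le> n" "i \<in> {1..k}" "j \<in> {1..k}" for u i j
    proof -
      have "{(Suc u, j), (u, i)} \<in> cyc_edges n k"
        unfolding cyc_edges_def cyc_verts_def mem_Collect_eq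
        by (rule exI[of _ "Suc u"], rule exI[of _ j], rule exI[of _ u], rule exI[of _ i])
          (use that in \<open>auto simp: cong_def\<close>)
      then show ?thesis using f unfolding Lip_def by blast
    qed
    have dist: "\<bar>f (u, i) - f (1, 1)\<bar> \<le> (int u + 1) * int M"
      if "1 \<le> u" "u \<le> n" "i \<in> {1..k}" for u i
      using that
    proof (induction u arbitrary: i rule: dec_induct)
      case base
      then show ?case using edge_step[of 1 i 1] edge_step[of 1 1 1] n k by auto
    next
      case (step u)
      have "\<bar>f (u, 1) - f (1, 1)\<bar> \<le> (int u + 1) * int M"
        using step.IH[of 1] step.prems k by auto
      moreover have "\<bar>f (Suc u, i) - f (u, 1)\<bar> \<le> int M"
        using edge_step[of u 1 i]
          step k by auto
      ultimately show ?case by (simp add: algebra_simps)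
    qed
    have D: "\<bar>f w - f (1, 1)\<bar> \<le> (int n + 1) * int M" if "w \<in> ?V" for w
    proof -
      obtain u i where w: "w = (u, i)" by (cases w)
      have "\<bar>f (u, i) - f (1, 1)\<bar> \<le> (int u + 1) * int M"
        by (rule dist) (use that w in \<open>auto simp: cyc_verts_def\<close>)
      also have "\<dots> \<le> (int n + 1) * int M"
        by (rule mult_right_mono) (use that w in \<open>auto simp: cyc_verts_def\<close>)
      finally show ?thesis by (simp add: w)
    qed
    have "f v0 = 0" using f by (simp add: Lip_def)
    then show ?thesis using D[OF v] D[OF v0] unfolding B_def by linarith
  qed
  have "Lip ?V (cyc_edges n k) v0 M \<subseteq> ?V \<rightarrow>\<^sub>E {- B..B}"
  proof
    fix f assume f: "f \<in> Lip ?V (cyc_edges n k) v0 M"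
    have "f x \<in> {- B..B}" if "x \<in> ?V" for x
      using bound[OF f that] by auto
    moreover have "f \<in> extensional ?V" using f by (auto simp: Lip_def PiE_def)
    ultimately show "f \<in> ?V \<rightarrow>\<^sub>E {- B..B}" by (auto simp: PiE_def)
  qed
  moreover have "finite (?V \<rightarrow>\<^sub>E {- B..B})"
    by (rule finite_PiE) (auto simp: cyc_verts_def)
  ultimately show ?thesis by (rule finite_subset)
qed

end

theory Submission
  imports Defs "HOL-Real_Asymp.Real_Asymp"
begin

text \<open>
  The range is large because somewhere along the cycle a short stretch of layers climbs steeply:
  this is unlikely at any given place, but there are many places.

  Cut the cycle into blocks of \<open>8 * m + 5\<close> inner layers, separated by single boundary layers,
  where \<open>m\<close> is \<open>C * \<gamma>\<close> rounded up.  Fix all values outside one block.  Either the boundary layers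
  already differ by \<open>m * M\<close>, or one can draw a tube through the block that rises by \<open>m * M\<close> above the
  first boundary layer and returns to the second one, such that every choice of values inside the
  tube is Lipschitz.  At each vertex the tube contains at least an eighth of the values
  that the Lipschitz condition allows.  This includes the layers next to the boundary, where the
  admissible window may be very small, since the tube is shrunk in proportion to it.  Hence a
  proportion of at least \<open>p = 8 ^ (- k * (8 * m + 5))\<close> of all completions varies by \<open>m * M\<close> within the
  block (\<open>many_steep_completions\<close>).  Resampling the blocks one after another shows that all of
  \<open>N\<close> blocks are flat with probability at most \<open>(1 - p) ^ N\<close> (\<open>card_all_flat_le\<close>).  For a small
  constant \<open>C\<close> the hypothesis \<open>k * \<gamma> \<le> log n\<close> gives \<open>p \<ge> 1 / sqrt n\<close>, while \<open>N\<close> is of order at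
  least \<open>n / log n\<close>, so that \<open>p * N\<close> tends to infinity.

  This needs \<open>C * \<gamma>\<close> to be bounded below, as otherwise rounding up to \<open>m \<ge> 1\<close> is too
  expensive for large \<open>k\<close>.  If \<open>C * \<gamma> \<le> 1 / 4\<close>, a direct count suffices: the functions with
  values in an interval of length \<open>M\<close> already outnumber those of range below \<open>M / 4\<close> by a factor
  \<open>2 ^ (n * k - 1)\<close> (\<open>card_range_below_quarter_le\<close>).
\<close>

section \<open>Lipschitz functions on the blown-up cycle, layer by layer\<close>

lemma layers_adjacent_iff:
  assumes "1 \<le> u" "u \<le> n" "1 \<le> w" "w \<le> n" "n \<ge> 2"
  shows "([int u - int w = 1] (mod int n) \<or> [int u - int w = - 1] (mod int n)) \<longleftrightarrow>
    u = Suc w \<or> w = Suc u \<or> (u = n \<and> w = 1) \<or> (u = 1 \<and> w = n)" (is "?L \<longleftrightarrow> ?R")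
proof
  have one_step: "x = Suc y \<or> (x = 1 \<and> y = n)"
    if dvd: "int n dvd int x - int y - 1" and r: "1 \<le> x" "x \<le> n" "1 \<le> y" "y \<le> n" for x y
  proof -
    from dvd obtain c where c: "int x - int y - 1 = int n * c" by (auto simp: dvd_def)
    have "c < 1"
    proof (rule ccontr)
      assume "\<not> c < 1"
      then have "int n * 1 \<le> int n * c" by (intro mult_left_mono) auto
      then show False using c r by linarith
    qed
    moreover have "c > - 2"
    proof (rule ccontr)
      assume "\<not> c > - 2"
      then have "int n * c \<le> int n * (- 2)" by (intro mult_left_mono) auto
      then show False using c r assms by linarith
    qed
    ultimately have "c = 0 \<or> c = - 1" by linarith
    then show ?thesis using c r by auto
  qed
  assume ?L
  then show ?R
  proof
    assume "[int u - int w = 1] (mod int n)"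
    then show ?R using one_step[of u w] assms by (auto simp: cong_iff_dvd_diff)
  next
    assume "[int u - int w = - 1] (mod int n)"
    then have "int n dvd - (int u - int w - - 1)"
      unfolding cong_iff_dvd_diff dvd_minus_iff .
    also have "- (int u - int w - - 1) = int w - int u - 1" by simp
    finally show ?R using one_step[of w u] assms by auto
  qed
next
  assume ?R
  then show ?L using assms by (auto simp: cong_iff_dvd_diff)
qed

lemma Lip_cyc_iff:
  assumes n: "n \<ge> 2"
  shows "f \<in> Lip (cyc_verts n k) (cyc_edges n k) v0 M \<longleftrightarrow>
    f \<in> extensional (cyc_verts n k) \<and> f v0 = 0 \<and>
    (\<forall>u i j. 1 \<le> u \<longrightarrow> u < n \<longrightarrow> i \<in> {1..k} \<longrightarrow> j \<in> {1..k} \<longrightarrow>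
       \<bar>f (u, i) - f (Suc u, j)\<bar> \<le> int M) \<and>
    (\<forall>i j. i \<in> {1..k} \<longrightarrow> j \<in> {1..k} \<longrightarrow> \<bar>f (n, i) - f (1, j)\<bar> \<le> int M)"
    (is "_ \<longleftrightarrow> ?ext \<and> ?zero \<and> ?step \<and> ?wrap")
proof -
  have edge: "{(u, i), (w, j)} \<in> cyc_edges n k \<longleftrightarrow>
      u \<in> {1..n} \<and> w \<in> {1..n} \<and> i \<in> {1..k} \<and> j \<in> {1..k} \<and>
      (u = Suc w \<or> w = Suc u \<or> (u = n \<and> w = 1) \<or> (u = 1 \<and> w = n))" for u i w j
  proof -
    have "{(u, i), (w, j)} \<in> cyc_edges n k \<longleftrightarrow>
      u \<in> {1..n} \<and> w \<in> {1..n} \<and> i \<in> {1..k} \<and> j \<in> {1..k} \<and>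
      (([int u - int w = 1] (mod int n) \<or> [int u - int w = - 1] (mod int n)) \<or>
       ([int w - int u = 1] (mod int n) \<or> [int w - int u = - 1] (mod int n)))"
      unfolding cyc_edges_def cyc_verts_def mem_Collect_eq doubleton_eq_iff by blast
    then show ?thesis
      using layers_adjacent_iff[of u n w] layers_adjacent_iff[of w n u] n by auto
  qed
  have "(\<forall>x y. {x, y} \<in> cyc_edges n k \<longrightarrow> \<bar>f x - f y\<bar> \<le> int M) \<longleftrightarrow> ?step \<and> ?wrap" (is "?A \<longleftrightarrow> _")
  proof (intro iffI conjI allI impI)
    fix u i j assume ?A "1 \<le> u" "u < n" "i \<in> {1..k}" "j \<in> {1..k}"
    then show "\<bar>f (u, i) - f (Suc u, j)\<bar> \<le> int M" using edge[of u i "Suc u" j] by auto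
  next
    fix i j assume ?A "i \<in> {1..k}" "j \<in> {1..k}"
    then show "\<bar>f (n, i) - f (1, j)\<bar> \<le> int M" using edge[of n i 1 j] n by auto
  next
    fix x y assume sw: "?step \<and> ?wrap" and xy: "{x, y} \<in> cyc_edges n k"
    obtain u i w j where "x = (u, i)" "y = (w, j)" by (cases x, cases y) 
    then show "\<bar>f x - f y\<bar> \<le> int M"
      using sw xy[unfolded \<open>x = _\<close> \<open>y = _\<close> edge] by (auto simp: abs_minus_commute)
  qed
  then show ?thesis by (auto simp: Lip_def PiE_def)
qed

section \<open>Averaging over fibres\<close>

text \<open>
  The resampling principle: a proportion that is guaranteed in every class of the partition
  induced by \<open>h\<close> is guaranteed overall.  Below, \<open>h\<close> forgets the values on one block, so that a
  class is the set of completions of one configuration outside that block.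
\<close>

lemma fraction_le_of_fibers:
  fixes p :: real
  assumes fin: "finite X"
    and fib: "\<And>x. x \<in> X \<Longrightarrow>
      p * real (card {y \<in> X. h y = h x}) \<le> real (card {y \<in> X. h y = h x \<and> P y})"
  shows "p * real (card X) \<le> real (card {x \<in> X. P x})"
proof -
  define w where "w x = (if P x then 1 else 0) - p" for x
  have sum_w: "sum w Y = real (card {y \<in> Y. P y}) - p * real (card Y)" if "finite Y" for Y
    using that by (simp add: w_def sum_subtractf sum.If_cases Int_def)
  have "0 \<le> (\<Sum>z\<in>h ` X. sum w {x. x \<in> X \<and> h x = z})"
  proof (rule sum_nonneg)
    fix z assume "z \<in> h ` X"
    then obtain x where "x \<in> X" "z = h x" by blast
    then show "0 \<le> sum w {x. x \<in> X \<and> h x = z}"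
      using fib[of x] fin by (subst sum_w) (auto simp: conj_assoc)
  qed
  also have "\<dots> = sum w X" by (rule sum.image_gen[OF fin, symmetric])
  finally show ?thesis using sum_w[OF fin] by simp
qed

section \<open>The values that a layer leaves to its neighbour\<close>

definition layer_max :: "nat \<Rightarrow> (nat \<times> nat \<Rightarrow> int) \<Rightarrow> nat \<Rightarrow> int" where
  "layer_max k f u = Max ((\<lambda>i. f (u, i)) ` {1..k})"

definition layer_min :: "nat \<Rightarrow> (nat \<times> nat \<Rightarrow> int) \<Rightarrow> nat \<Rightarrow> int" where
  "layer_min k f u = Min ((\<lambda>i. f (u, i)) ` {1..k})"

text \<open>
  Because consecutive layers are completely joined, a layer constrains the next one only
  through an interval of admissible values.
\<close>

lemma layer_window:
  assumes "k > 0"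
  shows "(\<forall>i\<in>{1..k}. \<bar>x - f (u, i)\<bar> \<le> int M) \<longleftrightarrow>
    layer_max k f u - int M \<le> x \<and> x \<le> layer_min k f u + int M"
proof -
  have ne: "(\<lambda>i. f (u, i)) ` {1..k} \<noteq> {}" and fin: "finite ((\<lambda>i. f (u, i)) ` {1..k})"
    using assms by auto
  have "layer_max k f u - int M \<le> x \<longleftrightarrow> layer_max k f u \<le> x + int M" by linarith
  also have "\<dots> \<longleftrightarrow> (\<forall>i\<in>{1..k}. f (u, i) \<le> x + int M)"
    unfolding layer_max_def using ne fin by (subst Max_le_iff) auto
  finally have 1: "layer_max k f u - int M \<le> x \<longleftrightarrow> (\<forall>i\<in>{1..k}. f (u, i) \<le> x + int M)" .
  have "x \<le> layer_min k f u + int M \<longleftrightarrow> x - int M \<le> layer_min k f u" by linarith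
  also have "\<dots> \<longleftrightarrow> (\<forall>i\<in>{1..k}. x - int M \<le> f (u, i))"
    unfolding layer_min_def using ne fin by (subst Min_ge_iff) auto
  finally have 2: "x \<le> layer_min k f u + int M \<longleftrightarrow> (\<forall>i\<in>{1..k}. x - int M \<le> f (u, i))" .
  show ?thesis unfolding 1 2 by (auto simp: abs_le_iff algebra_simps)
qed

lemma layer_max_attained:
  assumes "k > 0" shows "\<exists>i\<in>{1..k}. layer_max k f u = f (u, i)"
proof -
  have "layer_max k f u \<in> (\<lambda>i. f (u, i)) ` {1..k}"
    unfolding layer_max_def by (rule Max_in) (use assms in auto)
  then show ?thesis by auto
qed

lemma layer_min_le_max:
  assumes "k > 0" shows "layer_min k f u \<le> layer_max k f u"
proof -
  have "layer_min k f u \<le> f (u, 1)" "f (u, 1) \<le> layer_max k f u"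
    unfolding layer_min_def layer_max_def by (intro Min_le Max_ge; use assms in auto)+
  then show ?thesis by linarith
qed

section \<open>Resampling one block of layers\<close>

definition flat :: "nat \<Rightarrow> nat \<Rightarrow> nat \<Rightarrow> int \<Rightarrow> (nat \<times> nat \<Rightarrow> int) \<Rightarrow> bool" where
  "flat k a b r g \<longleftrightarrow> (\<forall>x\<in>{a..b} \<times> {1..k}. \<forall>y\<in>{a..b} \<times> {1..k}. g x - g y < r)"

text \<open>
  A block consists of the \<open>2 * t + 1\<close> layers strictly between the boundary layers \<open>a\<close> and
  \<open>b = a + 2 * t + 2\<close>.  It does not contain \<open>v0\<close> and does not meet the wrap-around between
  layers \<open>n\<close> and \<open>1\<close>, so \<open>f\<close> may be altered there without touching any other constraint.
\<close>

locale cyc_block =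
  fixes n k M t a :: nat and v0 :: "nat \<times> nat" and f :: "nat \<times> nat \<Rightarrow> int"
  assumes k: "k > 0" and M: "M > 0" and t: "t > 0"
    and a: "1 \<le> a" and b: "a + 2 * t + 2 \<le> n"
    and v0: "v0 \<notin> {a<..<a + 2 * t + 2} \<times> {1..k}"
    and f: "f \<in> Lip (cyc_verts n k) (cyc_edges n k) v0 M"
begin

abbreviation "F \<equiv> Lip (cyc_verts n k) (cyc_edges n k) v0 M"

abbreviation "b \<equiv> a + 2 * t + 2"

definition inner :: "(nat \<times> nat) set" where
  "inner = {a<..<b} \<times> {1..k}"

definition completions :: "(nat \<times> nat \<Rightarrow> int) set" where
  "completions = {g \<in> F. \<forall>x. x \<notin> inner \<longrightarrow> g x = f x}"

text \<open>
  In the two outermost inner layers \<open>{lo u..hi u}\<close> is the interval of values admitted by the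
  adjacent boundary layer; it can be as small as a single point.  In the other layers it is the
  interval of possible increments from the preceding layer.
\<close>

definition lo :: "nat \<Rightarrow> int" where
  "lo u = (if u = Suc a then layer_max k f a - int M
           else if u = b - 1 then layer_max k f b - int M else - int M)"

definition hi :: "nat \<Rightarrow> int" where
  "hi u = (if u = Suc a then layer_min k f a + int M
           else if u = b - 1 then layer_min k f b + int M else int M)"

lemma n2: "n \<ge> 2" using b by simp

lemma card_inner: "card inner = k * (2 * t + 1)"
  by (simp add: inner_def)

lemma finite_inner: "finite inner"
  by (simp add: inner_def)

lemma inner_subset: "inner \<subseteq> cyc_verts n k"
  using b a by (auto simp: inner_def cyc_verts_def)

lemma step:
  assumes "g \<in> F" "1 \<le> u" "u < n" "i \<in> {1..k}" "j \<in> {1..k}"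
  shows "\<bar>g (u, i) - g (Suc u, j)\<bar> \<le> int M"
  using assms by (simp add: Lip_cyc_iff[OF n2])

lemma value_in_end_window:
  assumes g: "g \<in> completions" and u: "u = Suc a \<or> u = b - 1" and i: "i \<in> {1..k}"
  shows "lo u \<le> g (u, i) \<and> g (u, i) \<le> hi u"
proof -
  have gF: "g \<in> F" and off: "\<And>j. g (a, j) = f (a, j)" "\<And>j. g (b, j) = f (b, j)"
    using g by (auto simp: completions_def inner_def)
  have "\<forall>j\<in>{1..k}. \<bar>g (Suc a, i) - f (a, j)\<bar> \<le> int M"
  proof
    fix j assume "j \<in> {1..k}"
    then show "\<bar>g (Suc a, i) - f (a, j)\<bar> \<le> int M"
      using step[OF gF, of a j i] a b i off(1)[of j] by (simp add: abs_minus_commute)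
  qed
  moreover have "\<forall>j\<in>{1..k}. \<bar>g (b - 1, i) - f (b, j)\<bar> \<le> int M"
  proof
    fix j assume "j \<in> {1..k}"
    then show "\<bar>g (b - 1, i) - f (b, j)\<bar> \<le> int M"
      using step[OF gF, of "b - 1" i j] a b i off(2)[of j] by simp
  qed
  ultimately show ?thesis
    using u t unfolding layer_window[OF k] lo_def hi_def by auto
qed

lemma f_completion: "f \<in> completions"
  using f by (simp add: completions_def)

lemma lo_le_hi: "lo u \<le> hi u"
proof (cases "u = Suc a \<or> u = b - 1")
  case True
  then show ?thesis using value_in_end_window[OF f_completion, of u 1] k by auto
qed (auto simp: lo_def hi_def)

lemma width_le: "hi u - lo u \<le> 2 * int M"
  using layer_min_le_max[OF k, of f a] layer_min_le_max[OF k, of f b]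
  by (auto simp: lo_def hi_def)

text \<open>
  A completion is determined by its values in the outermost inner layers together with, for every
  other vertex, its increment from the first vertex of the preceding layer.  It is important
  that the outermost layers are counted by their true windows and not by \<open>2 * M + 1\<close>: this is
  what makes the bound comparable with the lower bound for steep completions.
\<close>

lemma card_completions_le: 
  "card completions \<le> (\<Prod>x\<in>inner. card {lo (fst x)..hi (fst x)})"
proof -
  define \<phi> where "\<phi> g = (\<lambda>x\<in>inner.
    if fst x = Suc a \<or> fst x = b - 1 then g x else g x - g (fst x - 1, 1))"
    for g :: "nat \<times> nat \<Rightarrow> int"
  have "card completions \<le> card (\<Pi>\<^sub>E x\<in>inner. {lo (fst x)..hi (fst x)})"
  proof (rule card_inj_on_le[of \<phi>])
    show "finite (\<Pi>\<^sub>E x\<in>inner. {lo (fst x)..hi (fst x)})"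
      by (intro finite_PiE finite_inner) simp
    show "\<phi> ` completions \<subseteq> (\<Pi>\<^sub>E x\<in>inner. {lo (fst x)..hi (fst x)})"
    proof (rule image_subsetI)
      fix g assume g: "g \<in> completions"
      have "\<phi> g x \<in> {lo (fst x)..hi (fst x)}" if x: "x \<in> inner" for x
      proof -
        obtain u i where ui: "x = (u, i)" by (cases x)
        show ?thesis
        proof (cases "u = Suc a \<or> u = b - 1")
          case True
          then show ?thesis
            using value_in_end_window[OF g, of u i] x unfolding ui
            by (simp add: \<phi>_def inner_def)
        next
          case False
          then have "u > Suc a" "u < b" "i \<in> {1..k}" using x by (auto simp: ui inner_def)
          then have "\<bar>g (u, i) - g (u - 1, 1)\<bar> \<le> int M"
            using step[of g "u - 1" 1 i] g a b k
            by (auto simp: completions_def abs_minus_commute)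
          then show ?thesis using False x unfolding ui
            by (auto simp: \<phi>_def lo_def hi_def)
        qed
      qed
      then show "\<phi> g \<in> (\<Pi>\<^sub>E x\<in>inner. {lo (fst x)..hi (fst x)})"
        by (auto simp: \<phi>_def)
    qed
    show "inj_on \<phi> completions"
    proof (rule inj_onI)
      fix g g' assume g: "g \<in> completions" "g' \<in> completions" and eq: "\<phi> g = \<phi> g'"
      have eq_at: "\<phi> g x = \<phi> g' x" for x using eq by simp
      have "\<forall>i\<in>{1..k}. g (u, i) = g' (u, i)" if "Suc a \<le> u" "u < b" for u
        using that
      proof (induction u rule: dec_induct)
        case base
        show ?case
        proof
          fix i assume "i \<in> {1..k}"
          then show "g (Suc a, i) = g' (Suc a, i)"
            using eq_at[of "(Suc a, i)"] by (simp add: \<phi>_def inner_def)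
        qed
      next
        case (step u)
        show ?case
        proof
          fix i assume i: "i \<in> {1..k}"
          have "g (u, 1) = g' (u, 1)" using step k by auto
          then show "g (Suc u, i) = g' (Suc u, i)"
            using eq_at[of "(Suc u, i)"] i step by (auto simp: \<phi>_def inner_def split: if_splits)
        qed
      qed
      then have "g x = g' x" if "x \<in> inner" for x
        using that by (auto simp: inner_def)
      moreover have "g x = g' x" if "x \<notin> inner" for x
        using g that unfolding completions_def by (metis (mono_tags, lifting) mem_Collect_eq)
      ultimately show "g = g'" by blast
    qed
  qed
  also have "\<dots> = (\<Prod>x\<in>inner. card {lo (fst x)..hi (fst x)})"
    by (rule card_PiE[OF finite_inner])
  finally show ?thesis .
qed

text \<open>
  The steep completions are those that stay in the thin tube \<open>thin u\<close>, which has an eighth of the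
  width of \<open>{lo u..hi u}\<close> and hence is at most \<open>M div 4\<close> wide.  So the bottom of the
  tube may move by \<open>stride = M - M div 4\<close> per layer with all choices inside the tube still
  \<open>M\<close>-Lipschitz.  The bottom \<open>tent\<close> climbs at this rate from its prescribed value at one end and
  descends at the same rate to its prescribed value at the other end; as a minimum of two
  functions with slopes \<open>stride\<close> and \<open>- stride\<close> it never moves faster.
\<close>

definition stride :: int where "stride = int M - int M div 4"

definition tent :: "nat \<Rightarrow> int" where
  "tent u = min (lo (Suc a) + (int u - int (Suc a)) * stride)
                (lo (b - 1) + (int (b - 1) - int u) * stride)"

definition thin :: "nat \<Rightarrow> int set" where
  "thin u = {tent u..tent u + (hi u - lo u) div 8}"

lemma stride: "int M \<le> 2 * stride" "stride \<ge> 0"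
  unfolding stride_def by auto

lemma tent_step: "\<bar>tent u - tent (Suc u)\<bar> \<le> stride"
proof -
  have "lo (Suc a) + (int (Suc u) - int (Suc a)) * stride =
        lo (Suc a) + (int u - int (Suc a)) * stride + stride"
    "lo (b - 1) + (int (b - 1) - int (Suc u)) * stride =
     lo (b - 1) + (int (b - 1) - int u) * stride - stride"
    by (simp_all add: algebra_simps)
  then show ?thesis unfolding tent_def using stride(2) by linarith
qed

lemma thin_adjacent:
  assumes "x \<in> thin u" "y \<in> thin (Suc u)"
  shows "\<bar>x - y\<bar> \<le> int M"
proof -
  have "(hi u - lo u) div 8 \<le> int M div 4" for u
    using width_le[of u] by linarith
  from this[of u] this[of "Suc u"] show ?thesis
    using assms tent_step[of u] unfolding thin_def stride_def by auto
qed

lemma card_window_le: "card {lo u..hi u} \<le> 8 * card (thin u)"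
  using lo_le_hi[of u] by (simp add: thin_def)

text \<open>
  The block has length \<open>t = 4 * m + 2\<close> on either side of its middle since \<open>stride \<ge> M / 2\<close>:
  climbing for \<open>t\<close> layers gains \<open>2 * m * M + M\<close>.  This pays for the start of the tube at \<open>M\<close> below
  the maximum of the boundary layer, for the difference of less than \<open>m * M\<close> between the two
  ends, and for the height \<open>m * M\<close> that is wanted.
\<close>

context
  fixes m :: nat
  assumes t_eq: "t = 4 * m + 2"
    and ends: "\<bar>layer_max k f a - layer_max k f b\<bar> < int (m * M)"
begin

lemma height: "2 * int (m * M) + int M \<le> int t * stride"
proof -
  have "int t * int M \<le> int t * (2 * stride)"
    by (rule mult_left_mono) (use stride in auto)
  moreover have "int t * int M = 4 * int (m * M) + 2 * int M"
    by (simp add: t_eq algebra_simps)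
  ultimately show ?thesis by linarith
qed

lemma tent_ends: "tent (Suc a) = lo (Suc a)" "tent (b - 1) = lo (b - 1)"
proof -
  have "lo (b - 1) - lo (Suc a) = layer_max k f b - layer_max k f a"
    using t by (simp add: lo_def)
  moreover have "int (b - 1) - int (Suc a) = 2 * int t" by simp
  moreover have "int (m * M) \<ge> 0" by simp
  ultimately show "tent (Suc a) = lo (Suc a)" "tent (b - 1) = lo (b - 1)"
    using height ends unfolding tent_def by (auto simp: min_def)
qed

lemma tent_peak: "layer_max k f a + int (m * M) \<le> tent (Suc a + t)"
proof -
  have "lo (Suc a) = layer_max k f a - int M" "lo (b - 1) = layer_max k f b - int M"
    using t by (simp_all add: lo_def)
  moreover have "int (Suc a + t) - int (Suc a) = int t" "int (b - 1) - int (Suc a + t) = int t"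
    by simp_all
  moreover have "int (m * M) \<ge> 0" by simp
  ultimately show ?thesis using height ends unfolding tent_def by auto
qed

lemma thin_end_subset: "u = Suc a \<or> u = b - 1 \<Longrightarrow> thin u \<subseteq> {lo u..hi u}"
  using tent_ends lo_le_hi[of u] by (auto simp: thin_def)

text \<open>
  Edges between inner layers are controlled by the speed limit on the tube, edges to a boundary
  layer by the fact that the tube starts and ends inside the admissible windows.  The middle
  layer of the tube lies \<open>m * M\<close> above the maximum of layer \<open>a\<close>.
\<close>

lemma replace_inner:
  assumes h: "h \<in> (\<Pi>\<^sub>E x\<in>inner. thin (fst x))"
  defines "g \<equiv> \<lambda>x. if x \<in> inner then h x else f x"
  shows "g \<in> completions" and "\<not> flat k a b (int (m * M)) g"
proof -
  have thin: "g (u, i) \<in> thin u" if "a < u" "u < b" "i \<in> {1..k}" for u i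
    using PiE_mem[OF h, of "(u, i)"] that by (simp add: g_def inner_def)
  have out: "g (u, i) = f (u, i)" if "u \<le> a \<or> b \<le> u" for u i
    using that by (auto simp: g_def inner_def)
  have "g \<in> F"
    unfolding Lip_cyc_iff[OF n2]
  proof (intro conjI allI impI)
    show "g \<in> extensional (cyc_verts n k)"
      using f inner_subset by (auto simp: g_def Lip_cyc_iff[OF n2] extensional_def)
    show "g v0 = 0" using v0 f by (auto simp: g_def inner_def Lip_cyc_iff[OF n2])
  next
    fix i j assume "i \<in> {1..k}" "j \<in> {1..k}"
    then show "\<bar>g (n, i) - g (1, j)\<bar> \<le> int M"
      using f a b by (simp add: out Lip_cyc_iff[OF n2])
  next
    fix u i j assume u: "1 \<le> u" "u < n" and i: "i \<in> {1..k}" and j: "j \<in> {1..k}"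
    consider "Suc u \<le> a \<or> b \<le> u" | "u = a" | "u = b - 1" | "a < u" "Suc u < b" by linarith
    then show "\<bar>g (u, i) - g (Suc u, j)\<bar> \<le> int M"
    proof cases
      case 1
      then show ?thesis using step[OF f u i j] by (auto simp: out)
    next
      case 2
      have "g (Suc a, j) \<in> {lo (Suc a)..hi (Suc a)}"
        using thin[of "Suc a" j] thin_end_subset[of "Suc a"] j by auto
      then have "\<forall>i\<in>{1..k}. \<bar>g (Suc a, j) - f (a, i)\<bar> \<le> int M"
        unfolding layer_window[OF k] by (simp add: lo_def hi_def)
      then show ?thesis using i 2 by (simp add: out abs_minus_commute)
    next
      case 3
      have "g (b - 1, i) \<in> {lo (b - 1)..hi (b - 1)}"
        using thin[of "b - 1" i] thin_end_subset[of "b - 1"] i by auto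
      then have "\<forall>j\<in>{1..k}. \<bar>g (b - 1, i) - f (b, j)\<bar> \<le> int M"
        unfolding layer_window[OF k] using t by (simp add: lo_def hi_def)
      moreover have "Suc u = b" using 3 by simp
      ultimately show ?thesis using j 3 out[of b j] by auto
    next
      case 4
      then show ?thesis using thin_adjacent thin[of u i] thin[of "Suc u" j] i j by auto
    qed
  qed
  then show "g \<in> completions" by (auto simp: completions_def g_def)
  obtain i where i: "i \<in> {1..k}" "layer_max k f a = f (a, i)"
    using layer_max_attained[OF k] by blast
  have "g (Suc a + t, 1) \<in> thin (Suc a + t)" using thin k by simp
  then have "g (Suc a + t, 1) - g (a, i) \<ge> int (m * M)"
    using tent_peak i out[of a i] by (auto simp: thin_def)
  moreover have "(Suc a + t, 1) \<in> {a..b} \<times> {1..k}" "(a, i) \<in> {a..b} \<times> {1..k}"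
    using i k by auto
  ultimately show "\<not> flat k a b (int (m * M)) g" unfolding flat_def by (metis not_less)
qed

lemma prod_thin_le_card:
  assumes fin: "finite completions"
  shows "(\<Prod>x\<in>inner. card (thin (fst x))) \<le> card {g \<in> completions. \<not> flat k a b (int (m * M)) g}"
proof -
  define \<psi> where "\<psi> h = (\<lambda>x. if x \<in> inner then h x else f x)" for h
  have "(\<Prod>x\<in>inner. card (thin (fst x))) = card (\<Pi>\<^sub>E x\<in>inner. thin (fst x))"
    by (rule card_PiE[OF finite_inner, symmetric])
  also have "\<dots> \<le> card {g \<in> completions. \<not> flat k a b (int (m * M)) g}"
  proof (rule card_inj_on_le[of \<psi>])
    show "inj_on \<psi> (\<Pi>\<^sub>E x\<in>inner. thin (fst x))"
    proof (rule inj_onI)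
      fix h h' assume h: "h \<in> (\<Pi>\<^sub>E x\<in>inner. thin (fst x))" "h' \<in> (\<Pi>\<^sub>E x\<in>inner. thin (fst x))"
        and eq: "\<psi> h = \<psi> h'"
      have "h x = h' x" if "x \<in> inner" for x
        using fun_cong[OF eq, of x] that by (simp add: \<psi>_def)
      then show "h = h'" using PiE_ext[OF h] by blast
    qed
    show "\<psi> ` (\<Pi>\<^sub>E x\<in>inner. thin (fst x)) \<subseteq> {g \<in> completions. \<not> flat k a b (int (m * M)) g}"
      using replace_inner unfolding \<psi>_def by blast
  qed (use fin in simp)
  finally show ?thesis .
qed

end

text \<open>
  If the boundary layers themselves differ by \<open>m * M\<close>, no completion is flat.  Otherwise the tube
  exists, and at each of the \<open>k * (2 * t + 1)\<close> inner vertices it offers at least an eighth of the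
  choices that the upper bound allows.
\<close>

lemma many_steep_completions:
  assumes t_eq: "t = 4 * m + 2" and fin: "finite completions"
  shows "card completions \<le> 8 ^ (k * (2 * t + 1)) * card {g \<in> completions. \<not> flat k a b (int (m * M)) g}"
proof (cases "\<bar>layer_max k f a - layer_max k f b\<bar> < int (m * M)")
  case True
  have "card completions \<le> (\<Prod>x\<in>inner. card {lo (fst x)..hi (fst x)})"
    by (rule card_completions_le)
  also have "\<dots> \<le> (\<Prod>x\<in>inner. 8 * card (thin (fst x)))"
    by (rule prod_mono) (use card_window_le in auto)
  also have "\<dots> = 8 ^ (k * (2 * t + 1)) * (\<Prod>x\<in>inner. card (thin (fst x)))"
    by (simp add: prod.distrib card_inner)
  also have "\<dots> \<le> 8 ^ (k * (2 * t + 1)) * card {g \<in> completions. \<not> flat k a b (int (m * M)) g}"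
    by (intro mult_left_mono prod_thin_le_card t_eq True fin) simp
  finally show ?thesis .
next
  case False
  obtain i j where ij: "i \<in> {1..k}" "layer_max k f a = f (a, i)"
      "j \<in> {1..k}" "layer_max k f b = f (b, j)"
    using layer_max_attained[OF k] by metis
  have "\<not> flat k a b (int (m * M)) g" if "g \<in> completions" for g
  proof -
    have "g (a, i) = f (a, i)" "g (b, j) = f (b, j)"
      using that by (auto simp: completions_def inner_def)
    then have "g (a, i) - g (b, j) \<ge> int (m * M) \<or> g (b, j) - g (a, i) \<ge> int (m * M)"
      using False ij by linarith
    moreover have "(a, i) \<in> {a..b} \<times> {1..k}" "(b, j) \<in> {a..b} \<times> {1..k}"
      using ij by auto
    ultimately show ?thesis unfolding flat_def by (metis not_less)
  qed
  then have "{g \<in> completions. \<not> flat k a b (int (m * M)) g} = completions" by auto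
  then show ?thesis by simp
qed

end

section \<open>Many blocks\<close>

text \<open>
  Consecutive blocks share only their boundary layers, so resampling the inside of one block does
  not affect whether the others are flat.  Each block in turn therefore multiplies the number of
  configurations that are flat so far by at most \<open>1 - p\<close>, where \<open>p\<close> is the proportion from
  \<open>many_steep_completions\<close>.
\<close>

lemma card_all_flat_le:
  fixes n k M m :: nat and v0 :: "nat \<times> nat" and J :: "nat set"
  defines "F \<equiv> Lip (cyc_verts n k) (cyc_edges n k) v0 M"
  defines "L \<equiv> 8 * m + 6"
  assumes k: "k > 0" and M: "M > 0" and finF: "finite F"
    and J: "finite J"
      "\<And>j. j \<in> J \<Longrightarrow> Suc (j * L) + L \<le> n \<and> v0 \<notin> {Suc (j * L)<..<Suc (j * L) + L} \<times> {1..k}"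
  shows "real (card {f \<in> F. \<forall>j\<in>J. flat k (Suc (j * L)) (Suc (j * L) + L) (int (m * M)) f})
    \<le> (1 - 1 / 8 ^ (k * (8 * m + 5))) ^ card J * real (card F)"
  using J
proof (induction J rule: finite_induct)
  case empty
  then show ?case by simp
next
  case (insert i J)
  let ?p = "1 / 8 ^ (k * (8 * m + 5)) :: real"
  let ?flat = "\<lambda>j. flat k (Suc (j * L)) (Suc (j * L) + L) (int (m * M))"
  define X where "X = {f \<in> F. \<forall>j\<in>J. ?flat j f}"
  define I where "I = {Suc (i * L)<..<Suc (i * L) + L} \<times> {1..k}"
  define h where "h f = restrict f (- I)" for f :: "nat \<times> nat \<Rightarrow> int"
  have finX: "finite X" using finF by (simp add: X_def)
  have IH: "real (card X) \<le> (1 - ?p) ^ card J * real (card F)"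
    using insert.IH insert.prems by (simp add: X_def)
  have L2: "L = 2 * (4 * m + 2) + 2" by (simp add: L_def)
  have h_eq: "h g = h f \<longleftrightarrow> (\<forall>x. x \<notin> I \<longrightarrow> g x = f x)" for f g
    by (auto simp: h_def restrict_def fun_eq_iff)
  have flat_cong: "?flat j g \<longleftrightarrow> ?flat j f" if "j \<noteq> i" and gf: "\<forall>x. x \<notin> I \<longrightarrow> g x = f x" for j f g
  proof -
    have "g x = f x" if x: "x \<in> {Suc (j * L)..Suc (j * L) + L} \<times> {1..k}" for x
    proof -
      have "fst x \<notin> {Suc (i * L)<..<Suc (i * L) + L}"
      proof (cases "j < i")
        case True
        then have "Suc j * L \<le> i * L" by (intro mult_right_mono) auto
        then show ?thesis using x by auto
      next
        case False
        then have "Suc i * L \<le> j * L" using \<open>j \<noteq> i\<close> by (intro mult_right_mono) auto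
        then show ?thesis using x by auto
      qed
      then have "x \<notin> I" by (auto simp: I_def)
      then show ?thesis using gf by blast
    qed
    then show ?thesis unfolding flat_def by simp
  qed
  have "?p * real (card X) \<le> real (card {f \<in> X. \<not> ?flat i f})"
  proof (rule fraction_le_of_fibers[where h = h, OF finX])
    fix f assume fX: "f \<in> X"
    interpret B: cyc_block n k M "4 * m + 2" "Suc (i * L)" v0 f
      using k M insert.prems[of i] fX by unfold_locales (auto simp: L2 X_def F_def)
    have inner: "B.inner = I" unfolding B.inner_def I_def by (simp add: L2)
    have fib: "{g \<in> X. h g = h f} = B.completions"
    proof -
      have "?flat j g" if "j \<in> J" and gf: "\<forall>x. x \<notin> I \<longrightarrow> g x = f x" for j g
        using fX flat_cong[OF _ gf, of j] that(1) insert.hyps(2) unfolding X_def by blast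
      then show ?thesis
        unfolding h_eq B.completions_def inner X_def F_def by blast
    qed
    have "card B.completions \<le> 8 ^ (k * (2 * (4 * m + 2) + 1)) *
        card {g \<in> B.completions. \<not> ?flat i g}"
      using B.many_steep_completions[of m] finX unfolding fib[symmetric] by (simp add: L2)
    then have "real (card B.completions) \<le> real (8 ^ (k * (8 * m + 5)) *
        card {g \<in> B.completions. \<not> ?flat i g})"
      unfolding of_nat_le_iff by (simp add: algebra_simps)
    moreover have "{g \<in> X. h g = h f \<and> \<not> ?flat i g} = {g \<in> B.completions. \<not> ?flat i g}"
      unfolding fib[symmetric] by auto
    ultimately show "?p * real (card {g \<in> X. h g = h f})
        \<le> real (card {g \<in> X. h g = h f \<and> \<not> ?flat i g})"
      unfolding fib by (simp add: field_simps)
  qed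
  moreover have "card X = card {f \<in> X. ?flat i f} + card {f \<in> X. \<not> ?flat i f}"
    using finX by (subst card_Un_disjoint[symmetric]) (auto intro: arg_cong[of _ _ card])
  ultimately have "real (card {f \<in> X. ?flat i f}) \<le> (1 - ?p) * real (card X)"
    by (simp add: algebra_simps)
  also have "\<dots> \<le> (1 - ?p) * ((1 - ?p) ^ card J * real (card F))"
    by (intro mult_left_mono IH) simp
  also have "{f \<in> X. ?flat i f} = {f \<in> F. \<forall>j\<in>insert i J. ?flat j f}"
    by (auto simp: X_def)
  finally show ?case using insert.hyps by (simp add: mult.assoc)
qed

lemma diff_less_lip_range:
  assumes "finite V" "x \<in> V" "y \<in> V"
  shows "f x - f y < lip_range V f"
proof -
  have "f x \<le> Max (f ` V)" "Min (f ` V) \<le> f y" using assms by auto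
  then show ?thesis unfolding lip_range_def by linarith
qed

section \<open>Ranges below a quarter of the Lipschitz constant\<close>

lemma card_PiE_pinned:
  assumes "finite V" "v \<in> V"
  shows "card (\<Pi>\<^sub>E x\<in>V. if x = v then {c} else S) = card S ^ (card V - 1)"
proof -
  have "(\<Prod>x\<in>V - {v}. card (if x = v then {c} else S)) = (\<Prod>x\<in>V - {v}. card S)"
    by (rule prod.cong) auto
  then show ?thesis
    using assms unfolding card_PiE[OF assms(1)] prod.remove[OF assms] by simp
qed

text \<open>
  Any assignment of values in \<open>{0..M}\<close> is \<open>M\<close>-Lipschitz, whereas range below \<open>M / 4\<close> confines
  every value to \<open>{- c..c}\<close> with \<open>2 * (2 * c + 1) \<le> M + 1\<close>.  So each vertex other than \<open>v0\<close>
  contributes a factor of at least 2.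
\<close>

lemma card_range_below_quarter_le:
  assumes V: "finite V" "v0 \<in> V" and E: "\<And>u v. {u, v} \<in> E \<Longrightarrow> u \<in> V \<and> v \<in> V"
    and fin: "finite (Lip V E v0 M)" and M: "M > 0"
  shows "2 ^ (card V - 1) * card {f \<in> Lip V E v0 M. 4 * lip_range V f < int M}
    \<le> card (Lip V E v0 M)"
proof -
  define c where "c = (int M - 1) div 4"
  have "{f \<in> Lip V E v0 M. 4 * lip_range V f < int M}
      \<subseteq> (\<Pi>\<^sub>E x\<in>V. if x = v0 then {0} else {- c..c})"
  proof
    fix f assume f: "f \<in> {f \<in> Lip V E v0 M. 4 * lip_range V f < int M}"
    then have f0: "f v0 = 0" and ext: "f \<in> extensional V" by (auto simp: Lip_def PiE_def)
    have "f x \<in> {- c..c}" if "x \<in> V" for x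
      using diff_less_lip_range[OF V(1) that V(2), of f] diff_less_lip_range[OF V(1) V(2) that, of f]
        f f0 by (simp add: c_def) linarith
    then show "f \<in> (\<Pi>\<^sub>E x\<in>V. if x = v0 then {0} else {- c..c})"
      using f0 ext by (auto simp: PiE_def)
  qed
  then have "card {f \<in> Lip V E v0 M. 4 * lip_range V f < int M}
      \<le> card (\<Pi>\<^sub>E x\<in>V. if x = v0 then {0} else {- c..c})"
    by (rule card_mono[rotated]) (intro finite_PiE V(1); simp)
  also have "\<dots> = card {- c..c} ^ (card V - 1)" by (rule card_PiE_pinned[OF V])
  finally have "2 ^ (card V - 1) * card {f \<in> Lip V E v0 M. 4 * lip_range V f < int M}
      \<le> (2 * card {- c..c}) ^ (card V - 1)"
    by (simp add: power_mult_distrib)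
  also have "\<dots> \<le> card {0..int M} ^ (card V - 1)"
  proof (rule power_mono)
    have "c \<ge> 0" "4 * c \<le> int M - 1" using M by (simp_all add: c_def)
    then show "2 * card {- c..c} \<le> card {0..int M}" by simp
  qed simp
  also have "\<dots> = card (\<Pi>\<^sub>E x\<in>V. if x = v0 then {0} else {0..int M})"
    by (rule card_PiE_pinned[OF V, symmetric])
  also have "\<dots> \<le> card (Lip V E v0 M)"
  proof (rule card_mono[OF fin], rule subsetI)
    fix f assume f: "f \<in> (\<Pi>\<^sub>E x\<in>V. if x = v0 then {0} else {0..int M})"
    have "f x \<in> {0..int M}" if "x \<in> V" for x
      using PiE_mem[OF f that] by (auto split: if_splits)
    moreover have "f v0 = 0" using PiE_mem[OF f V(2)] by simp
    moreover have "\<bar>f u - f v\<bar> \<le> int M" if "{u, v} \<in> E" for u v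
      using calculation(1)[of u] calculation(1)[of v] E[OF that] by auto
    ultimately show "f \<in> Lip V E v0 M"
      using f by (auto simp: Lip_def PiE_def)
  qed
  finally show ?thesis .
qed

lemma card_cyc_range_below_quarter_le:
  assumes n: "n \<ge> 2" and k: "k > 0" and M: "M > 0" and v0: "v0 \<in> cyc_verts n k"
  defines "F \<equiv> Lip (cyc_verts n k) (cyc_edges n k) v0 M"
  shows "real (card {f \<in> F. 4 * lip_range (cyc_verts n k) f < int M}) \<le> (1 / 2) ^ (n - 1) * real (card F)"
proof -
  have "n * 1 \<le> n * k" using k by (intro mult_left_mono) auto
  then have "(2::nat) ^ (n - 1) \<le> 2 ^ (card (cyc_verts n k) - 1)"
    by (intro power_increasing) (simp_all add: cyc_verts_def diff_le_mono)
  then have "2 ^ (n - 1) * card {f \<in> F. 4 * lip_range (cyc_verts n k) f < int M}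
      \<le> 2 ^ (card (cyc_verts n k) - 1) * card {f \<in> F. 4 * lip_range (cyc_verts n k) f < int M}"
    by (rule mult_right_mono) simp
  also have "\<dots> \<le> card F"
    unfolding F_def
    by (rule card_range_below_quarter_le)
      (use finite_Lip_cyc[OF n k v0] v0 M in \<open>auto simp: cyc_verts_def cyc_edges_def doubleton_eq_iff\<close>)
  finally have "real (2 ^ (n - 1) * card {f \<in> F. 4 * lip_range (cyc_verts n k) f < int M}) \<le> real (card F)"
    unfolding of_nat_le_iff .
  then show ?thesis by (simp add: field_simps)
qed

section \<open>Ranges that are a multiple of the Lipschitz constant\<close>

text \<open>
  A function of range at most \<open>m * M\<close> is flat on every block.  Blocks of period \<open>8 * m + 6\<close> are
  packed into layers \<open>1\<close> to \<open>n\<close>; the loss of 2 in the number of blocks accounts for rounding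
  and for the block that may contain \<open>v0\<close>.
\<close>

lemma card_cyc_range_le:
  fixes n k M m :: nat
  assumes n: "n \<ge> 2" and k: "k > 0" and M: "M > 0" and v0: "v0 \<in> cyc_verts n k"
  defines "F \<equiv> Lip (cyc_verts n k) (cyc_edges n k) v0 M"
  shows "real (card {f \<in> F. lip_range (cyc_verts n k) f \<le> int (m * M)})
    \<le> exp (- ((real (n - 1) / real (8 * m + 6) - 2) / 8 ^ (k * (8 * m + 5)))) * real (card F)"
proof -
  define L where "L = 8 * m + 6"
  define B where "B = (n - 1) div L"
  define J where "J = {..<B} - {(fst v0 - 1) div L}"
  let ?p = "1 / 8 ^ (k * (8 * m + 5)) :: real"
  let ?flat = "\<lambda>j. flat k (Suc (j * L)) (Suc (j * L) + L) (int (m * M))"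
  have L: "L > 0" by (simp add: L_def)
  have finF: "finite F" unfolding F_def by (rule finite_Lip_cyc[OF n k v0])
  have block: "Suc (j * L) + L \<le> n" if "j \<in> J" for j
  proof -
    have "Suc j * L \<le> B * L" using that by (intro mult_right_mono) (auto simp: J_def)
    also have "\<dots> \<le> n - 1" by (simp add: B_def)
    finally show ?thesis using n by simp
  qed
  have avoid: "v0 \<notin> {Suc (j * L)<..<Suc (j * L) + L} \<times> {1..k}" if "j \<in> J" for j
  proof
    assume "v0 \<in> {Suc (j * L)<..<Suc (j * L) + L} \<times> {1..k}"
    then have "j * L < fst v0 - 1" "fst v0 - 1 < j * L + L" by auto
    then have "(fst v0 - 1) div L = j"
      by (intro div_nat_eqI) (auto simp: algebra_simps)
    then show False using that by (simp add: J_def)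
  qed
  have "real (n - 1) / real L \<le> real B + 1"
  proof -
    have "n - 1 \<le> (B + 1) * L"
      using dividend_less_times_div[OF L, of "n - 1"] by (simp add: B_def algebra_simps)
    then have "real (n - 1) \<le> (real B + 1) * real L"
      by (metis of_nat_1 of_nat_add of_nat_le_iff of_nat_mult)
    then show ?thesis using L by (simp add: pos_divide_le_eq)
  qed
  moreover have "real B \<le> real (card J) + 1"
  proof -
    have "card {..<B} - card {(fst v0 - 1) div L} \<le> card J"
      unfolding J_def by (rule diff_card_le_card_Diff) simp
    then show ?thesis by simp
  qed
  ultimately have cardJ: "real (n - 1) / real L - 2 \<le> real (card J)" by simp
  have "{f \<in> F. lip_range (cyc_verts n k) f \<le> int (m * M)} \<subseteq> {f \<in> F. \<forall>j\<in>J. ?flat j f}"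
  proof clarify
    fix f j assume j: "j \<in> J" and small: "lip_range (cyc_verts n k) f \<le> int (m * M)"
    show "?flat j f"
      unfolding flat_def
    proof (intro ballI)
      fix x y assume "x \<in> {Suc (j * L)..Suc (j * L) + L} \<times> {1..k}"
        "y \<in> {Suc (j * L)..Suc (j * L) + L} \<times> {1..k}"
      then have "x \<in> cyc_verts n k" "y \<in> cyc_verts n k"
        using block[OF j] by (auto simp: cyc_verts_def)
      then have "f x - f y < lip_range (cyc_verts n k) f"
        by (intro diff_less_lip_range) (auto simp: cyc_verts_def)
      then show "f x - f y < int (m * M)" using small by linarith
    qed
  qed
  then have "real (card {f \<in> F. lip_range (cyc_verts n k) f \<le> int (m * M)})
      \<le> real (card {f \<in> F. \<forall>j\<in>J. ?flat j f})"
    using finF by (intro of_nat_mono card_mono) auto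
  also have "\<dots> \<le> (1 - ?p) ^ card J * real (card F)"
    unfolding F_def L_def
    by (rule card_all_flat_le)
      (use k M finF block avoid in \<open>auto simp: F_def L_def J_def\<close>)
  also have "(1 - ?p) ^ card J \<le> exp (- ?p) ^ card J"
    using exp_ge_add_one_self[of "- ?p"] by (intro power_mono) auto
  also have "exp (- ?p) ^ card J = exp (- (real (card J) * ?p))"
    unfolding exp_of_nat_mult[symmetric] by simp
  also have "\<dots> \<le> exp (- ((real (n - 1) / real L - 2) * ?p))"
    using mult_right_mono[OF cardJ, of ?p] by simp
  finally show ?thesis by (simp add: L_def mult_right_mono)
qed

section \<open>The range is at least a constant multiple of \<open>\<gamma> * M\<close>\<close>

theorem corollary1p9:
  "\<exists>(C::real) (\<delta>::nat \<Rightarrow> real). C > 0 \<and> (\<forall>n. \<delta> n \<ge> 0) \<and> \<delta> \<longlonglongrightarrow> 0 \<and>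
     (\<forall>(n::nat) (k::nat) (M::nat) (\<gamma>::real) v0.
        n \<ge> 4 \<longrightarrow> even n \<longrightarrow> k > 0 \<longrightarrow> M > 0 \<longrightarrow> \<gamma> > 0 \<longrightarrow> v0 \<in> cyc_verts n k \<longrightarrow>
        real k \<le> log 2 (real n) / \<gamma> \<longrightarrow>
        measure_pmf.prob (pmf_of_set (Lip (cyc_verts n k) (cyc_edges n k) v0 M))
          {f. real_of_int (lip_range (cyc_verts n k) f) < C * \<gamma> * real M} \<le> \<delta> n)"
proof -
  \<comment> \<open>The exponent is the number of usable blocks, at least \<open>(n - 1) / log n - 2\<close>, times the
    proportion of steep completions in each of them, at least \<open>1 / sqrt n\<close>.\<close>
  define \<epsilon> where "\<epsilon> n = exp (- (((real n - 1) / log 2 (real n) - 2) / sqrt (real n)))" for n :: nat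
  define \<delta> where "\<delta> n = (1 / 2) ^ (n - 1) + \<epsilon> n" for n :: nat
  have "\<epsilon> \<longlonglongrightarrow> 0" unfolding \<epsilon>_def by real_asymp
  moreover have "(\<lambda>n. (1 / 2 :: real) ^ (n - 1)) \<longlonglongrightarrow> 0" by real_asymp
  ultimately have lim: "\<delta> \<longlonglongrightarrow> 0" unfolding \<delta>_def using tendsto_add by fastforce
  have \<epsilon>_nonneg: "\<epsilon> n \<ge> 0" for n by (simp add: \<epsilon>_def)
  then have nonneg: "\<delta> n \<ge> 0" for n by (simp add: \<delta>_def)
  have "measure_pmf.prob (pmf_of_set (Lip (cyc_verts n k) (cyc_edges n k) v0 M))
      {f. real_of_int (lip_range (cyc_verts n k) f) < 1 / 400 * \<gamma> * real M} \<le> \<delta> n"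
    if n: "n \<ge> 4" and k: "k > 0" and M: "M > 0" and \<gamma>: "\<gamma> > 0" and v0: "v0 \<in> cyc_verts n k"
      and k\<gamma>: "real k \<le> log 2 (real n) / \<gamma>" for n k M :: nat and \<gamma> :: real and v0
  proof -
    let ?V = "cyc_verts n k"
    define F where "F = Lip ?V (cyc_edges n k) v0 M"
    have n2: "n \<ge> 2" using n by simp
    have finF: "finite F" and neF: "F \<noteq> {}"
      using finite_Lip_cyc[OF n2 k v0] zero_in_Lip[OF v0] by (auto simp: F_def)
    have posF: "real (card F) > 0" using finF neF by (simp add: card_gt_0_iff)
    define S where "S = {f \<in> F. real_of_int (lip_range ?V f) < 1 / 400 * \<gamma> * real M}"
    have prob: "measure_pmf.prob (pmf_of_set F)
        {f. real_of_int (lip_range ?V f) < 1 / 400 * \<gamma> * real M} = real (card S) / real (card F)"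
      using finF neF by (simp add: measure_pmf_of_set S_def Int_def)
    have "real (card S) \<le> \<delta> n * real (card F)"
    proof -
      consider (bounded) "\<gamma> \<le> 100"
        | (few_blocks) "(real n - 1) / log 2 (real n) - 2 < 0"
        | (steep) "\<gamma> > 100" "(real n - 1) / log 2 (real n) - 2 \<ge> 0"
        by linarith
      then show ?thesis
      proof cases
        case bounded
        then have "\<gamma> * real M \<le> 100 * real M" by (intro mult_right_mono) auto
        then have "S \<subseteq> {f \<in> F. 4 * lip_range ?V f < int M}"
          unfolding S_def by auto
        then have "real (card S) \<le> real (card {f \<in> F. 4 * lip_range ?V f < int M})"
          using finF by (intro of_nat_mono card_mono) auto
        also have "\<dots> \<le> (1 / 2) ^ (n - 1) * real (card F)"
          unfolding F_def by (rule card_cyc_range_below_quarter_le[OF n2 k M v0])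
        also have "\<dots> \<le> \<delta> n * real (card F)"
          using \<epsilon>_nonneg by (intro mult_right_mono) (auto simp: \<delta>_def)
        finally show ?thesis .
      next
        \<comment> \<open>Here \<open>n\<close> is so small that \<open>\<delta> n \<ge> 1\<close>.\<close>
        case few_blocks
        then have "((real n - 1) / log 2 (real n) - 2) / sqrt (real n) \<le> 0"
          by (intro divide_nonpos_nonneg) auto
        then have "1 \<le> \<epsilon> n" by (simp add: \<epsilon>_def)
        then have "1 \<le> \<delta> n" unfolding \<delta>_def by (simp add: add_increasing)
        then have "1 * real (card F) \<le> \<delta> n * real (card F)" by (intro mult_right_mono) auto
        moreover have "card S \<le> card F" using finF by (intro card_mono) (auto simp: S_def)
        ultimately show ?thesis by linarith
      next
        case steep
        \<comment> \<open>As \<open>\<gamma> / 400 > 1 / 4\<close>, rounding up multiplies by at most 5.\<close>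
        define m where "m = nat \<lceil>\<gamma> / 400\<rceil>"
        have m: "\<gamma> / 400 \<le> real m" "real m \<le> \<gamma> / 80" "m \<ge> 1"
          using steep unfolding m_def by linarith+
        have log: "real k * \<gamma> \<le> log 2 (real n)" using k\<gamma> \<gamma> by (simp add: field_simps)
        have "\<gamma> \<le> real k * \<gamma>" using k \<gamma> by simp
        then have \<gamma>_log: "\<gamma> \<le> log 2 (real n)" using log by simp
        \<comment> \<open>The constant \<open>1 / 400\<close> is small enough for both of the following: the period of the
          blocks is at most \<open>log n\<close>, and \<open>3 * k * (8 * m + 5) \<le> 39 * k * m \<le> (39 / 80) * log n\<close>.\<close>
        have blocks: "(real n - 1) / log 2 (real n) - 2 \<le> real (n - 1) / real (8 * m + 6) - 2"
        proof -
          have "real (8 * m + 6) \<le> log 2 (real n)" using m \<gamma>_log by simp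
          then show ?thesis using n by (simp add: of_nat_diff frac_le)
        qed
        have cost: "8 ^ (k * (8 * m + 5)) \<le> sqrt (real n)"
        proof -
          have "real k * real (8 * m + 5) \<le> real k * (13 * (\<gamma> / 80))"
            using m by (intro mult_left_mono) auto
          also have "\<dots> = 13 / 80 * (real k * \<gamma>)" by simp
          finally have "3 * (real k * real (8 * m + 5)) \<le> 1 / 2 * log 2 (real n)"
            using log \<open>\<gamma> \<le> real k * \<gamma>\<close> \<gamma> by linarith
          then have "(2::real) powr real (3 * (k * (8 * m + 5))) \<le> 2 powr (log 2 (real n) * (1 / 2))"
            by (intro powr_mono) simp_all
          also have "\<dots> = (2 powr log 2 (real n)) powr (1 / 2)"
            by (rule powr_powr[symmetric])
          also have "\<dots> = sqrt (real n)"
            using n by (simp add: powr_half_sqrt)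
          also have "(2::real) powr real (3 * (k * (8 * m + 5))) = 2 ^ (3 * (k * (8 * m + 5)))"
            by (rule powr_realpow) simp
          also have "\<dots> = 8 ^ (k * (8 * m + 5))"
            unfolding power_mult by simp
          finally show ?thesis .
        qed
        have "real (card S) \<le> real (card {f \<in> F. lip_range ?V f \<le> int (m * M)})"
        proof (intro of_nat_mono card_mono)
          have "\<gamma> / 400 * real M \<le> real m * real M" using m by (intro mult_right_mono) auto
          then show "S \<subseteq> {f \<in> F. lip_range ?V f \<le> int (m * M)}"
            unfolding S_def by (auto simp flip: of_int_le_iff[where 'a = real])
        qed (use finF in auto)
        also have "\<dots> \<le> exp (- ((real (n - 1) / real (8 * m + 6) - 2) / 8 ^ (k * (8 * m + 5)))) * real (card F)"
          unfolding F_def by (rule card_cyc_range_le[OF n2 k M v0])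
        also have "\<dots> \<le> \<epsilon> n * real (card F)"
        proof (rule mult_right_mono)
          let ?x = "(real n - 1) / log 2 (real n) - 2"
          let ?y = "real (n - 1) / real (8 * m + 6) - 2"
          let ?q = "8 ^ (k * (8 * m + 5)) :: real"
          have "?x / sqrt (real n) \<le> ?x / ?q"
            using steep cost n by (intro divide_left_mono) auto
          also have "\<dots> \<le> ?y / ?q"
            using blocks by (intro divide_right_mono) auto
          finally show "exp (- (?y / ?q)) \<le> \<epsilon> n" by (simp add: \<epsilon>_def)
        qed simp
        also have "\<dots> \<le> \<delta> n * real (card F)"
          by (intro mult_right_mono) (auto simp: \<delta>_def)
        finally show ?thesis .
      qed
    qed
    then show ?thesis
      unfolding F_def[symmetric] prob using posF by (simp add: pos_divide_le_eq)
  qed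
  then show ?thesis using lim nonneg by (intro exI[of _ "1 / 400"] exI[of _ \<delta>]) auto
qed

end
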